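(* Let $F:\mathbb{Z}^2\to I^3$ be an infinitesimally flexible Q-net with velocity diagram $V$. Then the metric duals $LB=\nu(F)$ and $\bar C=\nu(LV)$ are Kœnigs nets and related via Kœnigs duality. Thus $F$ and $LV$ are metric duals of Kœnigs nets and the relation between them is the metric dual to the Kœnigs duality.
   Context: $I^3$ is $\mathbb{R}^3$; the top view of $(x,y,z)$ is $(x,y)$; $L$ is the Euclidean motion $L(x,y,z)=(y,-x,-z)$. A discrete net is a map $F:\mathbb{Z}^2\to\mathbb{R}^3$ with edges $F_{ij}F_{i+1,j}$, $F_{ij}F_{i,j+1}$ and faces $\mathfrak f_{ij}=F_{ij}F_{i+1,j}F_{i+1,j+1}F_{i,j+1}$. It is a discrete Q-net if each face is planar. The metric duality $\nu$ maps the point $(a,b,w)$ to the plane $bx-ay+z-w=0$ and vice versa; it preserves incidence. The metric dual $\nu(G)$ of a Q-net $G$ is the net whose vertices are the $\nu$-images of the face planes of $G$; its faces correspond to the vertices of $G$ and lie in the $\nu$-images of these vertices, and its edges lie on the $\nu$-images of the edges of $G$. A net $F$ is infinitesimally flexible if there is a non-trivial discrete deformation vector field $V:\mathbb{Z}^2\to I^3$, called velocity diagram, such that: (a) the top view of $LV$ equals the top view of $F$; (b) each corresponding pair of faces $\mathfrak b,\mathfrak c$ of the dual nets $LB:=\nu(F)$, $\bar C:=\nu(LV)$ has vanishing mixed area, measured in the top view, where the mixed area of two quadrilaterals $P=(p_1,\dots,p_4)$, $Q=(q_1,\dots,q_4)$ in $\mathbb{R}^2$ is $\frac14\sum_{k=1}^4\big(\det(p_k,q_{k+1})+\det(q_k,p_{k+1})\big)$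 (indices mod 4); (c) for each face $\mathfrak f$ there are $\bar D_{\mathfrak f}\in\mathbb{R}^3$ and a matrix $T_{\mathfrak f}=\begin{pmatrix}0&c_3&0\\-c_3&0&0\\c_1&c_2&0\end{pmatrix}$ such that $V_{kl}=\bar D_{\mathfrak f}+T_{\mathfrak f}F_{kl}$ for each of the four vertices $F_{kl}$ of $\mathfrak f$. (It follows that $V$, and hence $LV$, is a Q-net.) Two discrete Q-nets are related via Kœnigs duality if corresponding faces have parallel corresponding edges and parallel non-corresponding diagonals: for corresponding faces $p_1p_2p_3p_4$ and $q_1q_2q_3q_4$, $p_kp_{k+1}\parallel q_kq_{k+1}$ (indices mod 4) and $p_1p_3\parallel q_2q_4$, $p_2p_4\parallel q_1q_3$. A Q-net is called a Kœnigs net if a Kœnigs dual net exists. The metric dual of Kœnigs duality is the relation between two Q-nets whose $\nu$-images are related via Kœnigs duality.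
   Formalization: The net F is assumed nondegenerate: every face lies in a non-vertical plane, no three vertices of a face are collinear, and adjacent faces lie in different planes; without this ν(F) is undefined or has edges of length zero (e.g. for planar F) and the claim fails. *)

theory Defs
  imports "HOL-Analysis.Analysis"
begin

type_synonym net = "int \<Rightarrow> int \<Rightarrow> real^3"

definition top_view :: "real^3 \<Rightarrow> real^2" where
  "top_view p = vector [p$1, p$2]"

definition L_motion :: "real^3 \<Rightarrow> real^3" where
  "L_motion p = vector [p$2, - p$1, - p$3]"

definition L_net :: "net \<Rightarrow> net" where
  "L_net V i j = L_motion (V i j)"

text \<open>The vertices of a quadrilateral are numbered from 0, with indices taken modulo 4.\<close>

definition net_face :: "net \<Rightarrow> int \<Rightarrow> int \<Rightarrow> nat \<Rightarrow> real^3" where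
  "net_face F i j k = [F i j, F (i + 1) j, F (i + 1) (j + 1), F i (j + 1)] ! (k mod 4)"

definition q_net :: "net \<Rightarrow> bool" where
  "q_net F \<longleftrightarrow> (\<forall>i j. coplanar (range (net_face F i j)))"

text \<open>For a face without three collinear vertices this is its plane; for a degenerate face it is
  a line or a point and hence never of the form \<open>nu_point p\<close> below.\<close>

definition face_plane :: "net \<Rightarrow> int \<Rightarrow> int \<Rightarrow> (real^3) set" where
  "face_plane F i j = affine hull (range (net_face F i j))"

definition nu_point :: "real^3 \<Rightarrow> (real^3) set" where
  "nu_point p = {q. p$2 * q$1 - p$1 * q$2 + q$3 - p$3 = 0}"

lemma nu_point_incidence: "q \<in> nu_point p \<longleftrightarrow> p \<in> nu_point q"
  by (auto simp: nu_point_def algebra_simps)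

lemma nu_point_inj: "nu_point p = nu_point q \<longleftrightarrow> p = q"
proof
  assume eq: "nu_point p = nu_point q"
  have mem: "r \<in> nu_point q" if "r \<in> nu_point p" for r
    using eq that by simp
  have "vector [0, 0, p$3] \<in> nu_point q"
    by (rule mem) (simp add: nu_point_def)
  moreover have "vector [1, 0, p$3 - p$2] \<in> nu_point q"
    by (rule mem) (simp add: nu_point_def)
  moreover have "vector [0, 1, p$3 + p$1] \<in> nu_point q"
    by (rule mem) (simp add: nu_point_def)
  ultimately show "p = q"
    by (simp add: nu_point_def vec_eq_iff forall_3)
qed simp

text \<open>Only planes that are not parallel to the z-axis are of the form \<open>nu_point p\<close>;
  \<open>nu_plane\<close> is meaningful for these planes only.\<close>

definition nu_plane :: "(real^3) set \<Rightarrow> real^3" where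
  "nu_plane P = (THE p. P = nu_point p)"

lemma nu_plane_nu_point [simp]: "nu_plane (nu_point p) = p"
  by (simp add: nu_plane_def nu_point_inj)

definition nonvertical_faces :: "net \<Rightarrow> bool" where
  "nonvertical_faces F \<longleftrightarrow> (\<forall>i j. \<exists>p. face_plane F i j = nu_point p)"

definition metric_dual :: "net \<Rightarrow> net" where
  "metric_dual G i j = nu_plane (face_plane G i j)"

text \<open>Face (i,j) of a metric dual corresponds to vertex (i+1,j+1) of the original net, so the
  dual of the dual is the original net with shifted indices. To say that a given net is a metric dual,
  an index shift is therefore allowed.\<close>

definition is_metric_dual_of :: "net \<Rightarrow> net \<Rightarrow> bool" where
  "is_metric_dual_of H G \<longleftrightarrow>
     nonvertical_faces G \<and> (\<exists>m n. \<forall>i j. H (i + m) (j + n) = metric_dual G i j)"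

text \<open>Nondegeneracy: each face is a proper quadrilateral with a nonvertical plane, so that its
  \<open>\<nu>\<close>-image exists, and adjacent faces have different planes, so that the edges of
  the metric dual do not shrink to points.\<close>

definition nondegenerate_net :: "net \<Rightarrow> bool" where
  "nondegenerate_net F \<longleftrightarrow>
     nonvertical_faces F \<and>
     (\<forall>i j. \<forall>k<4. \<not> collinear {net_face F i j k, net_face F i j (k + 1), net_face F i j (k + 2)}) \<and>
     (\<forall>i j. face_plane F i j \<noteq> face_plane F (i + 1) j \<and> face_plane F i j \<noteq> face_plane F i (j + 1))"

definition det2 :: "real^2 \<Rightarrow> real^2 \<Rightarrow> real" where
  "det2 p q = det (vector [p, q] :: real^2^2)"

definition mixed_area :: "(nat \<Rightarrow> real^2) \<Rightarrow> (nat \<Rightarrow> real^2) \<Rightarrow> real" where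
  "mixed_area p q = 1/4 * (\<Sum>k<4. det2 (p k) (q (k + 1)) + det2 (q k) (p (k + 1)))"

definition motion_matrix :: "real \<Rightarrow> real \<Rightarrow> real \<Rightarrow> real^3^3" where
  "motion_matrix c1 c2 c3 =
     vector [vector [0, c3, 0], vector [- c3, 0, 0], vector [c1, c2, 0]]"

text \<open>The maps \<open>p \<mapsto> D + motion_matrix c1 c2 c3 *v p\<close> are the infinitesimal
  isotropic congruences; a deformation is trivial if one of them induces it on the whole net.\<close>

definition trivial_deformation :: "net \<Rightarrow> net \<Rightarrow> bool" where
  "trivial_deformation F V \<longleftrightarrow>
     (\<exists>D c1 c2 c3. \<forall>i j. V i j = D + motion_matrix c1 c2 c3 *v F i j)"

definition velocity_diagram :: "net \<Rightarrow> net \<Rightarrow> bool" where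
  "velocity_diagram F V \<longleftrightarrow>
     \<not> trivial_deformation F V \<and>
     (\<forall>i j. top_view (L_net V i j) = top_view (F i j)) \<and>
     (\<forall>i j. mixed_area (top_view \<circ> net_face (metric_dual F) i j)
                      (top_view \<circ> net_face (metric_dual (L_net V)) i j) = 0) \<and>
     (\<forall>i j. \<exists>D c1 c2 c3. \<forall>k<4.
        net_face V i j k = D + motion_matrix c1 c2 c3 *v net_face F i j k)"

definition infinitesimally_flexible :: "net \<Rightarrow> bool" where
  "infinitesimally_flexible F \<longleftrightarrow> (\<exists>V. velocity_diagram F V)"

text \<open>Parallelism of the segments pq and rs. Segments of length zero have to be excluded:
  otherwise a constant net would be a Koenigs dual of every Q-net.\<close>

definition parallel_segments :: "real^3 \<Rightarrow> real^3 \<Rightarrow> real^3 \<Rightarrow> real^3 \<Rightarrow> bool" where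
  "parallel_segments p q r s \<longleftrightarrow> p \<noteq> q \<and> r \<noteq> s \<and> (\<exists>t. s - r = t *\<^sub>R (q - p))"

definition dual_quads :: "(nat \<Rightarrow> real^3) \<Rightarrow> (nat \<Rightarrow> real^3) \<Rightarrow> bool" where
  "dual_quads p q \<longleftrightarrow>
     (\<forall>k<4. parallel_segments (p k) (p (k + 1)) (q k) (q (k + 1))) \<and>
     parallel_segments (p 0) (p 2) (q 1) (q 3) \<and>
     parallel_segments (p 1) (p 3) (q 0) (q 2)"

definition koenigs_dual :: "net \<Rightarrow> net \<Rightarrow> bool" where
  "koenigs_dual P Q \<longleftrightarrow>
     q_net P \<and> q_net Q \<and> (\<forall>i j. dual_quads (net_face P i j) (net_face Q i j))"

definition koenigs_net :: "net \<Rightarrow> bool" where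
  "koenigs_net P \<longleftrightarrow> q_net P \<and> (\<exists>Q. koenigs_dual P Q)"

definition metric_dual_koenigs_dual :: "net \<Rightarrow> net \<Rightarrow> bool" where
  "metric_dual_koenigs_dual F G \<longleftrightarrow>
     q_net F \<and> q_net G \<and> nonvertical_faces F \<and> nonvertical_faces G \<and>
     koenigs_dual (metric_dual F) (metric_dual G)"

end

theory Submission imports Defs begin

text \<open>
  Let \<open>p\<close> and \<open>q\<close> be the metric duals of \<open>F\<close> and of \<open>LV\<close>. Condition (c) on the velocities
  says that on each face the height of \<open>LV\<close> is an affine function of the top view; as \<open>F\<close> and
  \<open>LV\<close> have the same top view, \<open>LV\<close> is again a Q-net with nonvertical faces, so \<open>q\<close> makes sense.

  The face of \<open>p\<close> dual to a vertex \<open>x\<close> of \<open>F\<close> lies in the plane \<open>\<nu>(x)\<close>, and its four edges are,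
  in the top view, parallel to the four edges of \<open>F\<close> at \<open>x\<close>: the difference of the duals of two
  planes annihilates the line common to these planes (\<open>cross2_common_points\<close>). The same
  holds for \<open>q\<close> and \<open>LV\<close>. Since the direction space of \<open>\<nu>(x)\<close> depends only on the top view of \<open>x\<close>
  and projects isomorphically to the xy-plane, corresponding edges of \<open>p\<close> and \<open>q\<close> are parallel
  in space, and everything that remains about a single face can be computed in the top view.

  There, mixed area is, up to the factor 1/4, the sum of the two determinants of non-corresponding
  diagonals (\<open>mixed_area_diagonals\<close>). For quadrilaterals with parallel edges these determinants
  are equal (\<open>cross2_diagonals_commute\<close>), so vanishing mixed area makes both vanish. This is the
  parallelism of non-corresponding diagonals.

  It remains to exclude segments of length zero. For \<open>p\<close> this follows from the
  nondegeneracy of \<open>F\<close>. A face of \<open>q\<close> with one edge of length zero is a single point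
  (\<open>vanishing_edge_imp_vanishing_quad\<close>), by the two diagonal relations. Such a collapse spreads to the
  neighbouring faces and hence to all of \<open>q\<close> (\<open>propagation_of_coincidence\<close>). Then \<open>LV\<close>
  lies in one plane, and the deformation is trivial, which is excluded.
\<close>

section \<open>Determinants of top views and direction spaces of dual planes\<close>

definition cross2 :: "real^3 \<Rightarrow> real^3 \<Rightarrow> real" where
  "cross2 u v = u$1 * v$2 - u$2 * v$1"

text \<open>The direction space of the plane \<open>nu_point v\<close>.\<close>

definition nu_directions :: "real^3 \<Rightarrow> (real^3) set" where
  "nu_directions v = {u. v$2 * u$1 - v$1 * u$2 + u$3 = 0}"

lemma cross2_simps:
  "cross2 (u + u') v = cross2 u v + cross2 u' v"
  "cross2 u (v + v') = cross2 u v + cross2 u v'"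
  "cross2 (u - u') v = cross2 u v - cross2 u' v"
  "cross2 u (v - v') = cross2 u v - cross2 u v'"
  "cross2 (- u) v = - cross2 u v"
  "cross2 u (- v) = - cross2 u v"
  "cross2 0 v = 0" "cross2 u 0 = 0" "cross2 u u = 0"
  by (simp_all add: cross2_def algebra_simps)

lemma cross2_sub_scaleR:
  "cross2 (w - s *\<^sub>R u - t *\<^sub>R u') v = cross2 w v - s * cross2 u v - t * cross2 u' v"
  by (simp add: cross2_def algebra_simps)

lemma cross2_swap: "cross2 v u = - cross2 u v"
  by (simp add: cross2_def)

lemma add_nonzero_if_cross2: "cross2 u v \<noteq> 0 \<Longrightarrow> u + v \<noteq> 0"
  using cross2_simps(1)[of u v v] cross2_simps(7)[of v] cross2_simps(9)[of v] by force

lemma nu_point_diff: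
  "p \<in> nu_point v \<Longrightarrow> q \<in> nu_point v \<Longrightarrow> q - p \<in> nu_directions v"
  by (simp add: nu_point_def nu_directions_def algebra_simps)

lemma nu_directions_add:
  "a \<in> nu_directions v \<Longrightarrow> b \<in> nu_directions v \<Longrightarrow> a + b \<in> nu_directions v"
  by (simp add: nu_directions_def algebra_simps)

lemma nu_directions_scaleR:
  "a \<in> nu_directions v \<Longrightarrow> c *\<^sub>R a \<in> nu_directions v"
  by (simp add: nu_directions_def algebra_simps flip: distrib_left)

lemma nu_directions_top_view:
  "top_view v = top_view w \<Longrightarrow> nu_directions v = nu_directions w"
  by (simp add: nu_directions_def top_view_def vec_eq_iff forall_2)

lemma nu_directions_eq_0_iff:
  "u \<in> nu_directions v \<Longrightarrow> u = 0 \<longleftrightarrow> u$1 = 0 \<and> u$2 = 0"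
  by (auto simp: nu_directions_def vec_eq_iff forall_3)

text \<open>The projection to the xy-plane is injective on \<open>nu_directions v\<close>, so a
  vanishing determinant of the top views already means parallelism in space.\<close>

lemma parallel_in_nu_directions:
  assumes "u \<in> nu_directions v" "u' \<in> nu_directions v" "cross2 u u' = 0" "u \<noteq> 0"
  shows "\<exists>t. u' = t *\<^sub>R u"
proof (cases "u$1 = 0")
  case True
  then have "u$2 \<noteq> 0" using assms nu_directions_eq_0_iff by blast
  then have "u' = (u'$2 / u$2) *\<^sub>R u"
    using assms(1,2,3) True
    by (auto simp: nu_directions_def cross2_def vec_eq_iff forall_3 field_simps)
  then show ?thesis ..
next
  case False
  have u3: "u$3 = v$1 * u$2 - v$2 * u$1" "u'$3 = v$1 * u'$2 - v$2 * u'$1"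
    using assms(1,2) by (auto simp: nu_directions_def)
  have "u'$2 * u$1 = u$2 * u'$1"
    using assms(3) by (simp add: cross2_def algebra_simps)
  then have "u'$2 = (u'$1 / u$1) * u$2" using False by (simp add: field_simps)
  then have "u' = (u'$1 / u$1) *\<^sub>R u"
    using False u3 by (simp add: vec_eq_iff forall_3) (simp add: field_simps)
  then show ?thesis ..
qed

lemma cross2_common_parallel:
  assumes "cross2 u w \<noteq> 0" "cross2 a u = 0" "cross2 b u = 0"
  shows "cross2 a b = 0"
proof -
  have "cross2 u w * cross2 a b = cross2 b u * cross2 w a - cross2 a u * cross2 w b"
    by (simp add: cross2_def algebra_simps)
  then show ?thesis using assms by simp
qed

lemma cross2_eq_0_trans:
  assumes "u \<in> nu_directions v" "u \<noteq> 0" "cross2 u a = 0" "cross2 u b = 0"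
  shows "cross2 a b = 0"
proof -
  have "u$1 * cross2 a b = 0" "u$2 * cross2 a b = 0"
    using assms(3,4) unfolding cross2_def by algebra+
  then show ?thesis using assms(1,2) nu_directions_eq_0_iff by auto
qed

lemma cross2_nonzero_transfer:
  assumes "a \<in> nu_directions v" "b \<in> nu_directions v" "a \<noteq> 0" "b \<noteq> 0"
    and "cross2 a d = 0" "cross2 b e = 0" "cross2 d e \<noteq> 0"
  shows "cross2 a b \<noteq> 0"
proof
  assume "cross2 a b = 0"
  then have "cross2 d b = 0" using cross2_eq_0_trans assms by blast
  then have "cross2 b d = 0" using cross2_swap by (metis neg_equal_0_iff_equal)
  then have "cross2 d e = 0" using cross2_eq_0_trans assms by blast
  then show False using assms by simp
qed

lemma affine_nu_point: "affine (nu_point p)"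
  unfolding affine_def
proof (intro ballI allI impI)
  fix x y :: "real^3" and s t :: real
  assume "x \<in> nu_point p" "y \<in> nu_point p" and t: "s + t = 1"
  then have x: "x$3 = p$3 - p$2 * x$1 + p$1 * x$2" and y: "y$3 = p$3 - p$2 * y$1 + p$1 * y$2"
    by (simp_all add: nu_point_def)
  have s: "s = 1 - t" using t by simp
  then show "s *\<^sub>R x + t *\<^sub>R y \<in> nu_point p"
    by (simp add: nu_point_def x y s algebra_simps)
qed

text \<open>To recognise the plane of a face, it suffices to find three of its vertices whose
  top views are not collinear: Cramer's rule then gives the affine coordinates of any point.\<close>

lemma affine_hull_eq_nu_point:
  assumes "S \<subseteq> nu_point p" "x \<in> S" "y \<in> S" "z \<in> S" "cross2 (y - x) (z - x) \<noteq> 0"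
  shows "affine hull S = nu_point p"
proof
  show "affine hull S \<subseteq> nu_point p"
    using assms(1) affine_nu_point by (rule hull_minimal)
  show "nu_point p \<subseteq> affine hull S"
  proof
    fix q assume q: "q \<in> nu_point p"
    let ?D = "cross2 (y - x) (z - x)"
    define s where "s = cross2 (q - x) (z - x) / ?D"
    define t where "t = cross2 (y - x) (q - x) / ?D"
    \<comment> \<open>The residual \<open>r\<close> has zero determinant with two independent directions.\<close>
    define r where "r = (q - x) - s *\<^sub>R (y - x) - t *\<^sub>R (z - x)"
    have dirs: "q - x \<in> nu_directions p" "y - x \<in> nu_directions p" "z - x \<in> nu_directions p"
      using assms q nu_point_diff by blast+
    have "cross2 r (y - x) = 0" "cross2 r (z - x) = 0"
      unfolding r_def s_def t_def cross2_sub_scaleR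
      using assms(5) by (simp_all add: cross2_simps(9) cross2_swap[of "y - x" "q - x"] cross2_swap[of "z - x" "y - x"])
    moreover have "r \<in> nu_directions p"
      unfolding r_def diff_conv_add_uminus[of _ "_ *\<^sub>R _"] scaleR_minus_left[symmetric]
      using dirs by (intro nu_directions_add nu_directions_scaleR)
    ultimately have "r = 0"
      using cross2_eq_0_trans assms(5) by blast
    then have "q = (1 - s - t) *\<^sub>R x + s *\<^sub>R y + t *\<^sub>R z"
      by (simp add: r_def algebra_simps)
    then have "q \<in> affine hull {x, y, z}"
      unfolding affine_hull_3 by force
    moreover have "affine hull {x, y, z} \<subseteq> affine hull S"
      using assms by (intro hull_mono) auto
    ultimately show "q \<in> affine hull S" by blast
  qed
qed

lemma cross2_nonzero_if_not_collinear:
  assumes "x \<in> nu_point p" "y \<in> nu_point p" "z \<in> nu_point p" "\<not> collinear {x, y, z}"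
  shows "cross2 (x - y) (z - y) \<noteq> 0"
proof
  assume "cross2 (x - y) (z - y) = 0"
  moreover have "x - y \<in> nu_directions p" "z - y \<in> nu_directions p"
    using assms nu_point_diff by blast+
  ultimately have "x - y = 0 \<or> (\<exists>t. z - y = t *\<^sub>R (x - y))"
    using parallel_in_nu_directions by blast
  then have "collinear {0, x - y, z - y}"
    using collinear_lemma by blast
  then have "collinear {x, y, z}" by (subst collinear_3) auto
  then show False using assms by blast
qed

text \<open>Subtracting the equations of \<open>nu_point p\<close> and \<open>nu_point q\<close> gives the equation of the top
  view of their common line, and the vector \<open>q - p\<close> appears in it as the direction of the line.\<close>

lemma cross2_common_points:
  assumes "x \<in> nu_point p" "x \<in> nu_point q" "y \<in> nu_point p" "y \<in> nu_point q"
  shows "cross2 (q - p) (y - x) = 0"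
  using assms by (simp add: nu_point_def cross2_def algebra_simps)

section \<open>Quadrilaterals with parallel edges and zero mixed area\<close>

text \<open>The area of a quadrilateral is half the determinant of its diagonals, and mixed
  area is the polarisation of this quadratic form.\<close>

lemma mixed_area_diagonals:
  assumes "p 4 = p 0" "q 4 = q 0"
  shows "mixed_area (top_view \<circ> p) (top_view \<circ> q)
    = 1/4 * (cross2 (p 2 - p 0) (q 3 - q 1) + cross2 (q 2 - q 0) (p 3 - p 1))"
  using assms
  by (simp add: mixed_area_def det2_def det_2 top_view_def cross2_def
      numeral_eq_Suc lessThan_Suc algebra_simps)

text \<open>The vectors \<open>a, b, c, d\<close> and \<open>a', b', c', d'\<close> are the edges of two closed quadrilaterals.
  The difference of both sides is the determinant of \<open>d = - (a + b + c)\<close> and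
  \<open>d' = - (a' + b' + c')\<close>, up to terms that vanish by the parallelism of the other edges.\<close>

lemma cross2_diagonals_commute:
  assumes "a + b + c + d = 0" "a' + b' + c' + d' = 0"
    and "cross2 a a' = 0" "cross2 b b' = 0" "cross2 c c' = 0" "cross2 d d' = 0"
  shows "cross2 (a + b) (b' + c') = cross2 (a' + b') (b + c)"
proof -
  have d: "d = - (a + b + c)" "d' = - (a' + b' + c')"
    using assms(1,2) unfolding eq_neg_iff_add_eq_0 by (simp_all only: add_ac)
  have "cross2 (a + b + c) (a' + b' + c') = 0"
    using assms(6) by (simp add: d cross2_simps)
  then show ?thesis
    using assms(3-5) cross2_swap[of b a'] cross2_swap[of b b'] cross2_swap[of c a'] cross2_swap[of c b']
    by (simp add: cross2_simps)
qed

text \<open>If \<open>a' = 0\<close>, the diagonal \<open>a' + b'\<close> is the edge \<open>b'\<close>, so \<open>b'\<close> is parallel both to \<open>b\<close> and to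
  \<open>b + c\<close>, hence to the independent vectors \<open>b\<close> and \<open>c\<close>. In the same way \<open>b' + c' = - d'\<close> is
  parallel both to \<open>d\<close> and to \<open>c + d\<close>.\<close>

lemma vanishing_edge_imp_vanishing_quad:
  assumes dirs: "b' \<in> nu_directions v" "d' \<in> nu_directions v"
    and "a + b + c + d = 0" "a' + b' + c' + d' = 0"
    and par: "cross2 b b' = 0" "cross2 d d' = 0"
    and indep: "cross2 b c \<noteq> 0" "cross2 c d \<noteq> 0"
    and diag: "cross2 (a + b) (b' + c') = 0" "cross2 (a' + b') (b + c) = 0"
    and "a' = 0"
  shows "b' = 0 \<and> c' = 0 \<and> d' = 0"
proof -
  have "cross2 b' b = 0" "cross2 b' c = 0"
    using diag(2) \<open>a' = 0\<close> par(1) cross2_swap[of b' b] by (simp_all add: cross2_simps)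
  then have b': "b' = 0"
    using cross2_eq_0_trans dirs(1) indep(1) by blast
  then have "d' = - c'" "a + b = - (c + d)"
    using assms(3,4) \<open>a' = 0\<close> b' unfolding eq_neg_iff_add_eq_0 by (simp_all add: add_ac)
  then have "cross2 (c + d) d' = 0"
    using diag(1) b' by (simp add: cross2_simps)
  then have "cross2 d' c = 0" "cross2 d' d = 0"
    using par(2) cross2_swap[of d'] by (simp_all add: cross2_simps)
  then have "d' = 0"
    using cross2_eq_0_trans dirs(2) indep(2) by blast
  then show ?thesis using b' \<open>d' = - c'\<close> by simp
qed

lemma parallel_segmentsI:
  assumes "q - p \<in> nu_directions v" "s - r \<in> nu_directions v"
    and "cross2 (q - p) (s - r) = 0" "q \<noteq> p" "s \<noteq> r"
  shows "parallel_segments p q r s"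
  using parallel_in_nu_directions[of "q - p" v "s - r"] assms
  by (auto simp: parallel_segments_def)

text \<open>The alternative that \<open>q\<close> is a single point cannot be excluded for one face alone, since
  it satisfies all hypotheses. The last inequality shows that in the other case \<open>q\<close> spans a
  plane, which identifies this plane with \<open>nu_point w\<close>.\<close>

lemma parallel_quads_zero_mixed_area:
  fixes p q :: "nat \<Rightarrow> real^3"
  assumes per: "p 4 = p 0" "q 4 = q 0"
    and in_p: "\<And>k. p k \<in> nu_point v" and in_q: "\<And>k. q k \<in> nu_point w"
    and vw: "top_view v = top_view w"
    and par: "cross2 (p 1 - p 0) (q 1 - q 0) = 0" "cross2 (p 2 - p 1) (q 2 - q 1) = 0"
      "cross2 (p 3 - p 2) (q 3 - q 2) = 0" "cross2 (p 0 - p 3) (q 0 - q 3) = 0"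
    and indep: "cross2 (p 1 - p 0) (p 2 - p 1) \<noteq> 0" "cross2 (p 2 - p 1) (p 3 - p 2) \<noteq> 0"
      "cross2 (p 3 - p 2) (p 0 - p 3) \<noteq> 0" "cross2 (p 0 - p 3) (p 1 - p 0) \<noteq> 0"
    and area: "mixed_area (top_view \<circ> p) (top_view \<circ> q) = 0"
  shows "(q 0 = q 1 \<and> q 1 = q 2 \<and> q 2 = q 3) \<or>
    (q 0 \<noteq> q 1 \<and> q 1 \<noteq> q 2 \<and> q 2 \<noteq> q 3 \<and> q 3 \<noteq> q 0 \<and> dual_quads p q \<and>
     cross2 (q 1 - q 0) (q 2 - q 1) \<noteq> 0)"
proof -
  define a b c d where abcd: "a = p 1 - p 0" "b = p 2 - p 1" "c = p 3 - p 2" "d = p 0 - p 3"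
  define a' b' c' d' where abcd':
    "a' = q 1 - q 0" "b' = q 2 - q 1" "c' = q 3 - q 2" "d' = q 0 - q 3"
  have dp: "p k - p l \<in> nu_directions v" for k l using in_p nu_point_diff by blast
  have dq: "q k - q l \<in> nu_directions v" for k l
    using in_q nu_point_diff nu_directions_top_view[OF vw] by blast
  have dirs: "a \<in> nu_directions v" "b \<in> nu_directions v" "c \<in> nu_directions v" "d \<in> nu_directions v"
    "a' \<in> nu_directions v" "b' \<in> nu_directions v" "c' \<in> nu_directions v" "d' \<in> nu_directions v"
    unfolding abcd abcd' using dp dq by blast+
  have par': "cross2 a a' = 0" "cross2 b b' = 0" "cross2 c c' = 0" "cross2 d d' = 0"
    using par by (simp_all add: abcd abcd')
  have ind: "cross2 a b \<noteq> 0" "cross2 b c \<noteq> 0" "cross2 c d \<noteq> 0" "cross2 d a \<noteq> 0"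
    using indep by (simp_all add: abcd)
  then have nz: "a \<noteq> 0" "b \<noteq> 0" "c \<noteq> 0" "d \<noteq> 0"
    using cross2_simps(7) by metis+
  have sum0: "a + b + c + d = 0" "a' + b' + c' + d' = 0"
    by (simp_all add: abcd abcd')
  have diags: "a + b = p 2 - p 0" "b + c = p 3 - p 1" "a' + b' = q 2 - q 0" "b' + c' = q 3 - q 1"
    by (simp_all add: abcd abcd')
  have "cross2 (a + b) (b' + c') + cross2 (a' + b') (b + c) = 0"
    using area mixed_area_diagonals[OF per] unfolding diags by simp
  then have diag: "cross2 (a + b) (b' + c') = 0" "cross2 (a' + b') (b + c) = 0"
    using cross2_diagonals_commute[OF sum0 par'] by simp_all
  have opp: "c + d = - (a + b)" "d + a = - (b + c)" "c' + d' = - (a' + b')" "d' + a' = - (b' + c')"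
    using sum0 unfolding eq_neg_iff_add_eq_0 by (simp_all only: add_ac)
  \<comment> \<open>A cyclic shift of the four edges preserves the two diagonal relations up to sign.\<close>
  have diag': "cross2 (b + c) (c' + d') = 0" "cross2 (b' + c') (c + d) = 0"
    "cross2 (c + d) (d' + a') = 0" "cross2 (c' + d') (d + a) = 0"
    "cross2 (d + a) (a' + b') = 0" "cross2 (d' + a') (a + b) = 0"
    unfolding opp using diag cross2_swap[of "b + c" "a' + b'"] cross2_swap[of "b' + c'" "a + b"]
    by (simp_all only: cross2_simps(5,6) minus_minus minus_zero)
  have sums: "b + c + d + a = 0" "c + d + a + b = 0" "d + a + b + c = 0"
    "b' + c' + d' + a' = 0" "c' + d' + a' + b' = 0" "d' + a' + b' + c' = 0"
    using sum0 by (simp_all only: add_ac)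
  note vanish = vanishing_edge_imp_vanishing_quad
  have all0: "a' = 0 \<and> b' = 0 \<and> c' = 0 \<and> d' = 0"
    if "a' = 0 \<or> b' = 0 \<or> c' = 0 \<or> d' = 0"
    using that
  proof (elim disjE)
    assume z: "a' = 0"
    from vanish[OF dirs(6,8) sum0 par'(2,4) ind(2,3) diag z] z show ?thesis by blast
  next
    assume z: "b' = 0"
    from vanish[OF dirs(7,5) sums(1,4) par'(3,1) ind(3,4) diag'(1,2) z] z show ?thesis by blast
  next
    assume z: "c' = 0"
    from vanish[OF dirs(8,6) sums(2,5) par'(4,2) ind(4,1) diag'(3,4) z] z show ?thesis by blast
  next
    assume z: "d' = 0"
    from vanish[OF dirs(5,7) sums(3,6) par'(1,3) ind(1,2) diag'(5,6) z] z show ?thesis by blast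
  qed
  show ?thesis
  proof (cases "a' = 0 \<or> b' = 0 \<or> c' = 0 \<or> d' = 0")
    case True
    then have "a' = 0" "b' = 0" "c' = 0" using all0 by blast+
    then show ?thesis by (simp add: abcd')
  next
    case False
    then have nz': "a' \<noteq> 0" "b' \<noteq> 0" "c' \<noteq> 0" "d' \<noteq> 0" by blast+
    have parc: "cross2 a' a = 0" "cross2 b' b = 0" "cross2 c' c = 0"
      using par' cross2_swap[of a a'] cross2_swap[of b b'] cross2_swap[of c c'] by simp_all
    have ind': "cross2 a' b' \<noteq> 0" "cross2 b' c' \<noteq> 0"
      using cross2_nonzero_transfer dirs nz' parc ind by blast+
    have dnz: "a + b \<noteq> 0" "b + c \<noteq> 0" "a' + b' \<noteq> 0" "b' + c' \<noteq> 0"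
      using ind(1,2) ind' add_nonzero_if_cross2 by blast+
    have "parallel_segments (p k) (p (k + 1)) (q k) (q (k + 1))" if "k < 4" for k
    proof (rule parallel_segmentsI)
      consider "k = 0" | "k = 1" | "k = 2" | "k = 3" using \<open>k < 4\<close> by linarith
      then show "p (k + 1) \<noteq> p k" "q (k + 1) \<noteq> q k"
        using nz nz' per by (cases; simp add: abcd abcd' eval_nat_numeral)+
      show "cross2 (p (k + 1) - p k) (q (k + 1) - q k) = 0"
        using \<open>k < 4\<close> par per by (auto simp: less_Suc_eq numeral_eq_Suc)
    qed (use dp dq in auto)
    moreover have "parallel_segments (p 0) (p 2) (q 1) (q 3)"
      using dp dq diag dnz unfolding diags by (intro parallel_segmentsI[of _ _ v]) auto
    moreover have "parallel_segments (p 1) (p 3) (q 0) (q 2)"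
      using dp dq diag' dnz cross2_swap[of "b + c" "a' + b'"] diag
      unfolding diags by (intro parallel_segmentsI[of _ _ v]) auto
    ultimately have "dual_quads p q" by (simp add: dual_quads_def)
    then show ?thesis using nz' ind' by (auto simp: abcd')
  qed
qed

lemma parallel_segments_sym: "parallel_segments p q r s \<Longrightarrow> parallel_segments r s p q"
proof -
  assume "parallel_segments p q r s"
  then obtain t where t: "p \<noteq> q" "r \<noteq> s" "s - r = t *\<^sub>R (q - p)"
    by (auto simp: parallel_segments_def)
  then have "t \<noteq> 0" by auto
  then have "q - p = (1 / t) *\<^sub>R (s - r)" using t(3) by simp
  then show ?thesis using t(1,2) unfolding parallel_segments_def by blast
qed

lemma koenigs_dual_sym: "koenigs_dual P Q \<Longrightarrow> koenigs_dual Q P"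
  unfolding koenigs_dual_def dual_quads_def using parallel_segments_sym by blast

section \<open>Propagation of a collapsed face\<close>

text \<open>Adjacent faces share an edge, so a face that has collapsed to a point makes each
  of its neighbours collapse to the same point.\<close>

lemma propagation_of_coincidence:
  fixes g :: "int \<Rightarrow> int \<Rightarrow> 'a"
  assumes spread: "\<And>i j. g i j = g (i+1) j \<or> g (i+1) j = g (i+1) (j+1) \<or>
       g (i+1) (j+1) = g i (j+1) \<or> g i (j+1) = g i j \<Longrightarrow>
     g i j = g (i+1) j \<and> g (i+1) j = g (i+1) (j+1) \<and> g (i+1) (j+1) = g i (j+1)"
    and start: "g i0 j0 = g (i0+1) j0"
  shows "g i j = g i0 j0"
proof -
  define Z where "Z i j \<longleftrightarrow> g i j = g (i+1) j \<and> g (i+1) j = g (i+1) (j+1) \<and> g (i+1) (j+1) = g i (j+1)"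
    for i j
  have Z: "Z i j" if "g i j = g (i+1) j \<or> g (i+1) j = g (i+1) (j+1) \<or>
       g (i+1) (j+1) = g i (j+1) \<or> g i (j+1) = g i j" for i j
    using spread[OF that] by (simp add: Z_def)
  have right: "Z (i+1) j" and up: "Z i (j+1)" if "Z i j" for i j
    using that Z[of "i+1" j] Z[of i "j+1"] unfolding Z_def by metis+
  have left: "Z (i-1) j \<and> g (i-1) j = g i j" and down: "Z i (j-1) \<and> g i (j-1) = g i j"
    if "Z i j" for i j
    using that Z[of "i-1" j] Z[of i "j-1"] unfolding Z_def diff_add_cancel by metis+
  have Z0: "Z i0 j0" using Z start by blast
  have row: "Z i j0 \<and> g i j0 = g i0 j0" for i
  proof (induction i rule: int_induct[where k = i0])
    case base then show ?case using Z0 by blast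
  next
    case (step1 i) then show ?case using right unfolding Z_def by metis
  next
    case (step2 i) then show ?case using left by metis
  qed
  \<comment> \<open>From the row of \<open>j0\<close> every column can be reached.\<close>
  have "Z i j \<and> g i j = g i0 j0"
  proof (induction j rule: int_induct[where k = j0])
    case base then show ?case using row by blast
  next
    case (step1 j) then show ?case using up unfolding Z_def by metis
  next
    case (step2 j) then show ?case using down by metis
  qed
  then show ?thesis ..
qed

section \<open>Metric duals of nets\<close>

text \<open>The indices also occur in unary form, into which the simplifier turns sums \<open>k + 1\<close>.\<close>

lemma net_face_simps [simp]:
  "net_face F i j 0 = F i j" "net_face F i j (Suc 0) = F (i+1) j" "net_face F i j 1 = F (i+1) j"
  "net_face F i j (Suc (Suc 0)) = F (i+1) (j+1)" "net_face F i j (Suc (Suc (Suc 0))) = F i (j+1)"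
  "net_face F i j 2 = F (i+1) (j+1)" "net_face F i j 3 = F i (j+1)"
  "net_face F i j 4 = F i j" "net_face F i j 5 = F (i+1) j"
  by (simp_all add: net_face_def)

lemma range_net_face:
  "range (net_face F i j) = {F i j, F (i+1) j, F (i+1) (j+1), F i (j+1)}"
proof -
  have "net_face F i j k \<in> {F i j, F (i+1) j, F (i+1) (j+1), F i (j+1)}" for k
  proof -
    consider "k mod 4 = 0" | "k mod 4 = 1" | "k mod 4 = 2" | "k mod 4 = 3" by linarith
    then show ?thesis by cases (simp_all add: net_face_def)
  qed
  moreover have "F i j \<in> range (net_face F i j)" "F (i+1) j \<in> range (net_face F i j)"
    "F (i+1) (j+1) \<in> range (net_face F i j)" "F i (j+1) \<in> range (net_face F i j)"
    by (metis net_face_simps rangeI)+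
  ultimately show ?thesis by blast
qed

lemma face_plane_metric_dual:
  assumes "nonvertical_faces G"
  shows "face_plane G i j = nu_point (metric_dual G i j)"
  using assms by (metis metric_dual_def nonvertical_faces_def nu_plane_nu_point)

lemma net_in_nu_point_metric_dual:
  assumes "nonvertical_faces G"
  shows "G i j \<in> nu_point (metric_dual G i j)" "G (i+1) j \<in> nu_point (metric_dual G i j)"
    "G (i+1) (j+1) \<in> nu_point (metric_dual G i j)" "G i (j+1) \<in> nu_point (metric_dual G i j)"
  using face_plane_metric_dual[OF assms, of i j] hull_subset[of "range (net_face G i j)" affine]
  by (auto simp: face_plane_def range_net_face)

text \<open>The four faces around a vertex contain it, so by incidence their duals lie in the dual
  plane of the vertex.\<close>

lemma metric_dual_face_in_nu_point:
  assumes "nonvertical_faces G"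
  shows "range (net_face (metric_dual G) i j) \<subseteq> nu_point (G (i+1) (j+1))"
  using net_in_nu_point_metric_dual[OF assms] nu_point_incidence
  by (simp add: range_net_face add.assoc)

lemma coplanar_nu_point:
  assumes "S \<subseteq> nu_point p" shows "coplanar S"
proof -
  have "affine hull {vector [0, 0, p$3], vector [1, 0, p$3 - p$2], vector [0, 1, p$3 + p$1]} = nu_point p"
    by (rule affine_hull_eq_nu_point[of _ _ "vector [0, 0, p$3]" "vector [1, 0, p$3 - p$2]" "vector [0, 1, p$3 + p$1]"])
      (auto simp: nu_point_def cross2_def)
  then show ?thesis using assms unfolding coplanar_def by blast
qed

lemma metric_dual_q_net:
  "nonvertical_faces G \<Longrightarrow> q_net (metric_dual G)"
  unfolding q_net_def using metric_dual_face_in_nu_point coplanar_nu_point by blast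

text \<open>The independence of two edges ensures that each face of the dual net spans the plane
  \<open>\<nu>\<close> of the corresponding vertex. This recovers \<open>G\<close>, with both indices shifted by 1.\<close>

lemma metric_dual_involution:
  assumes "nonvertical_faces G"
    and "\<And>i j. cross2 (metric_dual G (i+1) j - metric_dual G i j)
                (metric_dual G (i+1) (j+1) - metric_dual G (i+1) j) \<noteq> 0"
  shows "is_metric_dual_of G (metric_dual G)"
proof -
  have "face_plane (metric_dual G) i j = nu_point (G (i+1) (j+1))" for i j
    unfolding face_plane_def
  proof (rule affine_hull_eq_nu_point[OF metric_dual_face_in_nu_point[OF assms(1)]])
    show "cross2 (metric_dual G (i+1) j - metric_dual G i j)
            (metric_dual G (i+1) (j+1) - metric_dual G i j) \<noteq> 0"
      using assms(2)[of i j] by (simp add: cross2_def algebra_simps)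
  qed (auto simp: range_net_face)
  then show ?thesis
    unfolding is_metric_dual_of_def nonvertical_faces_def metric_dual_def
    by (metis nu_plane_nu_point)
qed

text \<open>Each edge of the dual face joins the duals of the two planes that meet along an edge of
  the star of the corresponding vertex \<open>G (i+1) (j+1)\<close>.\<close>

lemma dual_face_edges_along_star:
  assumes "nonvertical_faces G"
  defines "g \<equiv> metric_dual G"
  shows "cross2 (g (i+1) j - g i j) (G (i+1) j - G (i+1) (j+1)) = 0"
    "cross2 (g (i+1) (j+1) - g (i+1) j) (G (i+2) (j+1) - G (i+1) (j+1)) = 0"
    "cross2 (g i (j+1) - g (i+1) (j+1)) (G (i+1) (j+2) - G (i+1) (j+1)) = 0"
    "cross2 (g i j - g i (j+1)) (G i (j+1) - G (i+1) (j+1)) = 0"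
proof -
  note mem = net_in_nu_point_metric_dual[OF assms(1), folded g_def]
  show "cross2 (g (i+1) j - g i j) (G (i+1) j - G (i+1) (j+1)) = 0"
    "cross2 (g (i+1) (j+1) - g (i+1) j) (G (i+2) (j+1) - G (i+1) (j+1)) = 0"
    "cross2 (g i (j+1) - g (i+1) (j+1)) (G (i+1) (j+2) - G (i+1) (j+1)) = 0"
    "cross2 (g i j - g i (j+1)) (G i (j+1) - G (i+1) (j+1)) = 0"
    using mem[of i j] mem[of "i+1" j] mem[of i "j+1"] mem[of "i+1" "j+1"]
    by (auto intro!: cross2_common_points simp: add.assoc)
qed

text \<open>Because the face planes are not vertical, the corners of the faces remain nondegenerate
  in the top view.\<close>

lemma face_corners_independent:
  assumes "nondegenerate_net F"
  shows "cross2 (F i j - F (i+1) j) (F (i+1) (j+1) - F (i+1) j) \<noteq> 0"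
    "cross2 (F (i+1) j - F (i+1) (j+1)) (F i (j+1) - F (i+1) (j+1)) \<noteq> 0"
    "cross2 (F (i+1) (j+1) - F i (j+1)) (F i j - F i (j+1)) \<noteq> 0"
    "cross2 (F i (j+1) - F i j) (F (i+1) j - F i j) \<noteq> 0"
proof -
  have nv: "nonvertical_faces F" and
    nc: "\<And>k. k < 4 \<Longrightarrow> \<not> collinear {net_face F i j k, net_face F i j (k+1), net_face F i j (k+2)}"
    using assms by (auto simp: nondegenerate_net_def)
  note mem = net_in_nu_point_metric_dual[OF nv, of i j]
  show "cross2 (F i j - F (i+1) j) (F (i+1) (j+1) - F (i+1) j) \<noteq> 0"
    using nc[of 0] mem cross2_nonzero_if_not_collinear by (simp add: numeral_2_eq_2[symmetric])
  show "cross2 (F (i+1) j - F (i+1) (j+1)) (F i (j+1) - F (i+1) (j+1)) \<noteq> 0"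
    using nc[of 1] mem cross2_nonzero_if_not_collinear by simp
  show "cross2 (F (i+1) (j+1) - F i (j+1)) (F i j - F i (j+1)) \<noteq> 0"
    using nc[of 2] mem cross2_nonzero_if_not_collinear by simp
  show "cross2 (F i (j+1) - F i j) (F (i+1) j - F i j) \<noteq> 0"
    using nc[of 3] mem cross2_nonzero_if_not_collinear by simp
qed

section \<open>The velocity diagram\<close>

text \<open>The third row of the motion matrix gives the height over the face as an affine
  function of the top view of \<open>F\<close>, which is also the top view of \<open>LV\<close>. The coefficients
  of this function form the dual point of the plane.\<close>

lemma velocity_face_in_plane:
  assumes "velocity_diagram F V"
  shows "\<exists>p. range (net_face (L_net V) i j) \<subseteq> nu_point p"
proof -
  obtain D c1 c2 c3 where
    V: "\<And>k. k < 4 \<Longrightarrow> net_face V i j k = D + motion_matrix c1 c2 c3 *v net_face F i j k"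
    using assms unfolding velocity_diagram_def by metis
  have top: "top_view (L_net V i j) = top_view (F i j)" for i j
    using assms by (simp add: velocity_diagram_def)
  have key: "L_motion y \<in> nu_point (vector [- c2, c1, - D$3])"
    if "y = D + motion_matrix c1 c2 c3 *v x" "top_view (L_motion y) = top_view x" for x y
  proof -
    have "y$3 = D$3 + c1 * x$1 + c2 * x$2"
      using that(1) by (simp add: motion_matrix_def matrix_vector_mult_def sum_3)
    then show ?thesis
      using that(2)
      by (simp add: L_motion_def nu_point_def top_view_def vec_eq_iff forall_2 algebra_simps)
  qed
  have "net_face (L_net V) i j k \<in> nu_point (vector [- c2, c1, - D$3])" if "k < 4" for k
  proof -
    have "net_face (L_net V) i j k = L_motion (net_face V i j k)"
      "top_view (net_face (L_net V) i j k) = top_view (net_face F i j k)"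
      using that top by (auto simp: less_Suc_eq numeral_eq_Suc L_net_def)
    then show ?thesis using key[OF V[OF that]] by metis
  qed
  from this[of 0] this[of 1] this[of 2] this[of 3]
  have "range (net_face (L_net V) i j) \<subseteq> nu_point (vector [- c2, c1, - D$3])"
    by (simp add: range_net_face)
  then show ?thesis ..
qed

lemma cross2_cong_top_view:
  assumes "top_view x = top_view x'" "top_view y = top_view y'" "top_view z = top_view z'"
  shows "cross2 (x - y) (z - y) = cross2 (x' - y') (z' - y')"
  using assms by (simp add: cross2_def top_view_def vec_eq_iff forall_2)

lemma velocity_nonvertical_faces:
  assumes "nondegenerate_net F" "velocity_diagram F V"
  shows "nonvertical_faces (L_net V)"
  unfolding nonvertical_faces_def
proof (intro allI)
  fix i j
  obtain p where p: "range (net_face (L_net V) i j) \<subseteq> nu_point p"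
    using velocity_face_in_plane assms(2) by blast
  have top: "top_view (L_net V i j) = top_view (F i j)" for i j
    using assms(2) by (simp add: velocity_diagram_def)
  have "face_plane (L_net V) i j = nu_point p"
    unfolding face_plane_def
  proof (rule affine_hull_eq_nu_point[OF p])
    show "cross2 (L_net V i (j+1) - L_net V i j) (L_net V (i+1) j - L_net V i j) \<noteq> 0"
      using face_corners_independent(4)[OF assms(1)]
      by (simp add: cross2_cong_top_view[OF top top top])
  qed (auto simp: range_net_face)
  then show "\<exists>p. face_plane (L_net V) i j = nu_point p" ..
qed

text \<open>Equality of the top views determines the horizontal part of \<open>V\<close> as the rotation field with
  \<open>c3 = -1\<close>; the common plane supplies the remaining coefficients.\<close>

lemma trivial_if_common_plane:
  assumes "\<And>i j. top_view (L_net V i j) = top_view (F i j)" "\<And>i j. L_net V i j \<in> nu_point p"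
  shows "trivial_deformation F V"
  unfolding trivial_deformation_def
proof (intro exI allI)
  fix i j
  show "V i j = vector [0, 0, - p$3] + motion_matrix (p$2) (- p$1) (-1) *v F i j"
    using assms(1)[of i j] assms(2)[of i j]
    by (simp add: L_net_def L_motion_def nu_point_def top_view_def vec_eq_iff forall_2 forall_3
        motion_matrix_def matrix_vector_mult_def sum_3 algebra_simps)
qed

text \<open>The edges of \<open>F\<close> at the vertex \<open>F (i+1) (j+1)\<close> mediate between \<open>p\<close> and \<open>q\<close>: in the top
  view, the edges of both dual faces are parallel to them. Consecutive ones lie in a common face
  of \<open>F\<close> and are independent, and this property passes to the edges of \<open>p\<close>.\<close>

lemma dual_face_dichotomy:
  assumes nd: "nondegenerate_net F" and vel: "velocity_diagram F V"
  defines "p \<equiv> metric_dual F" and "q \<equiv> metric_dual (L_net V)"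
  shows "(q i j = q (i+1) j \<and> q (i+1) j = q (i+1) (j+1) \<and> q (i+1) (j+1) = q i (j+1)) \<or>
    (q i j \<noteq> q (i+1) j \<and> q (i+1) j \<noteq> q (i+1) (j+1) \<and> q (i+1) (j+1) \<noteq> q i (j+1) \<and> q i (j+1) \<noteq> q i j \<and>
     dual_quads (net_face p i j) (net_face q i j) \<and>
     cross2 (q (i+1) j - q i j) (q (i+1) (j+1) - q (i+1) j) \<noteq> 0)" (is ?dich)
    and "cross2 (p (i+1) j - p i j) (p (i+1) (j+1) - p (i+1) j) \<noteq> 0"
proof -
  have nv: "nonvertical_faces F" using nd by (simp add: nondegenerate_net_def)
  have nvL: "nonvertical_faces (L_net V)" using velocity_nonvertical_faces nd vel .
  have top: "top_view (L_net V i j) = top_view (F i j)" for i j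
    using vel by (simp add: velocity_diagram_def)
  have p_in: "net_face p i j k \<in> nu_point (F (i+1) (j+1))" for k
    using metric_dual_face_in_nu_point[OF nv] unfolding p_def by blast
  have q_in: "net_face q i j k \<in> nu_point (L_net V (i+1) (j+1))" for k
    using metric_dual_face_in_nu_point[OF nvL] unfolding q_def by blast
  let ?x = "F (i+1) (j+1)"
  define e0 e1 e2 e3 where
    e: "e0 = F (i+1) j - ?x" "e1 = F (i+2) (j+1) - ?x" "e2 = F (i+1) (j+2) - ?x" "e3 = F i (j+1) - ?x"
  have e_indep: "cross2 e0 e1 \<noteq> 0" "cross2 e1 e2 \<noteq> 0" "cross2 e2 e3 \<noteq> 0" "cross2 e3 e0 \<noteq> 0"
    using face_corners_independent(3)[OF nd, of "i+1" j] face_corners_independent(4)[OF nd, of "i+1" "j+1"]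
      face_corners_independent(1)[OF nd, of i "j+1"] face_corners_independent(2)[OF nd, of i j]
      cross2_swap[of e0 e1] cross2_swap[of e1 e2] cross2_swap[of e2 e3] cross2_swap[of e3 e0]
    unfolding e by (simp_all add: add.assoc)
  have p_par: "cross2 (p (i+1) j - p i j) e0 = 0" "cross2 (p (i+1) (j+1) - p (i+1) j) e1 = 0"
    "cross2 (p i (j+1) - p (i+1) (j+1)) e2 = 0" "cross2 (p i j - p i (j+1)) e3 = 0"
    unfolding e p_def by (fact dual_face_edges_along_star[OF nv])+
  have "cross2 u (L_net V k l - L_net V m n) = cross2 u (F k l - F m n)" for u k l m n
    using top[of k l] top[of m n] by (simp add: cross2_def top_view_def vec_eq_iff forall_2)
  then have q_par: "cross2 (q (i+1) j - q i j) e0 = 0" "cross2 (q (i+1) (j+1) - q (i+1) j) e1 = 0"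
    "cross2 (q i (j+1) - q (i+1) (j+1)) e2 = 0" "cross2 (q i j - q i (j+1)) e3 = 0"
    using dual_face_edges_along_star[OF nvL, of i j] unfolding e q_def by simp_all
  have "p i j \<noteq> p (i+1) j" "p i j \<noteq> p i (j+1)" for i j
    using nd face_plane_metric_dual[OF nv] unfolding nondegenerate_net_def p_def by metis+
  then have p_nz: "p (i+1) j - p i j \<noteq> 0" "p (i+1) (j+1) - p (i+1) j \<noteq> 0"
    "p i (j+1) - p (i+1) (j+1) \<noteq> 0" "p i j - p i (j+1) \<noteq> 0"
    by (metis eq_iff_diff_eq_0)+
  have dirs: "net_face p i j k - net_face p i j l \<in> nu_directions ?x" for k l
    using p_in nu_point_diff by blast
  have p_dirs: "p (i+1) j - p i j \<in> nu_directions ?x" "p (i+1) (j+1) - p (i+1) j \<in> nu_directions ?x"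
    "p i (j+1) - p (i+1) (j+1) \<in> nu_directions ?x" "p i j - p i (j+1) \<in> nu_directions ?x"
    using dirs[of 1 0] dirs[of 2 1] dirs[of 3 2] dirs[of 0 3] by simp_all
  have p_indep: "cross2 (p (i+1) j - p i j) (p (i+1) (j+1) - p (i+1) j) \<noteq> 0"
    "cross2 (p (i+1) (j+1) - p (i+1) j) (p i (j+1) - p (i+1) (j+1)) \<noteq> 0"
    "cross2 (p i (j+1) - p (i+1) (j+1)) (p i j - p i (j+1)) \<noteq> 0"
    "cross2 (p i j - p i (j+1)) (p (i+1) j - p i j) \<noteq> 0"
    using cross2_nonzero_transfer p_dirs p_nz p_par e_indep by blast+
  then show "cross2 (p (i+1) j - p i j) (p (i+1) (j+1) - p (i+1) j) \<noteq> 0" by blast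
  have pq: "cross2 (p (i+1) j - p i j) (q (i+1) j - q i j) = 0"
    "cross2 (p (i+1) (j+1) - p (i+1) j) (q (i+1) (j+1) - q (i+1) j) = 0"
    "cross2 (p i (j+1) - p (i+1) (j+1)) (q i (j+1) - q (i+1) (j+1)) = 0"
    "cross2 (p i j - p i (j+1)) (q i j - q i (j+1)) = 0"
    using cross2_common_parallel e_indep p_par q_par by blast+
  have area: "mixed_area (top_view \<circ> net_face p i j) (top_view \<circ> net_face q i j) = 0"
    using vel by (simp add: velocity_diagram_def p_def q_def)
  show ?dich
    using parallel_quads_zero_mixed_area[OF _ _ p_in q_in top[symmetric] _ _ _ _ _ _ _ _ area]
      p_indep pq
    by simp
qed

section \<open>Infinitesimal flexibility and Koenigs duality\<close>

theorem proposition60: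
  fixes F V :: net
  assumes "q_net F"
    and "nondegenerate_net F"
    and "infinitesimally_flexible F"
    and "velocity_diagram F V"
  shows "koenigs_net (metric_dual F)
    \<and> koenigs_net (metric_dual (L_net V))
    \<and> koenigs_dual (metric_dual F) (metric_dual (L_net V))
    \<and> (\<exists>P. koenigs_net P \<and> is_metric_dual_of F P)
    \<and> (\<exists>Q. koenigs_net Q \<and> is_metric_dual_of (L_net V) Q)
    \<and> metric_dual_koenigs_dual F (L_net V)"
proof -
  define q where "q = metric_dual (L_net V)"
  have nv: "nonvertical_faces F" using assms(2) by (simp add: nondegenerate_net_def)
  have nvL: "nonvertical_faces (L_net V)" using velocity_nonvertical_faces assms(2,4) .
  note dich = dual_face_dichotomy(1)[OF assms(2,4), folded q_def]
  have qL: "q_net (L_net V)"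
    unfolding q_net_def using velocity_face_in_plane[OF assms(4)] coplanar_nu_point by blast
  have "q i j \<noteq> q (i+1) j" for i j
  proof
    assume "q i j = q (i+1) j"
    then have "q i' j' = q i j" for i' j'
      by (rule propagation_of_coincidence[rotated]) (use dich in blast)
    then have "L_net V i' j' \<in> nu_point (q i j)" for i' j'
      using net_in_nu_point_metric_dual(1)[OF nvL, folded q_def] by metis
    then have "trivial_deformation F V"
      using assms(4) by (intro trivial_if_common_plane) (auto simp: velocity_diagram_def)
    then show False using assms(4) by (simp add: velocity_diagram_def)
  qed
  then have quads: "dual_quads (net_face (metric_dual F) i j) (net_face q i j)"
    and indep: "cross2 (q (i+1) j - q i j) (q (i+1) (j+1) - q (i+1) j) \<noteq> 0" for i j
    using dich by blast+
  have kd: "koenigs_dual (metric_dual F) q"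
    unfolding koenigs_dual_def using metric_dual_q_net nv nvL quads by (auto simp: q_def)
  then have kn: "koenigs_net (metric_dual F)" "koenigs_net q"
    using koenigs_dual_sym unfolding koenigs_net_def koenigs_dual_def by blast+
  have "is_metric_dual_of F (metric_dual F)"
    using metric_dual_involution nv dual_face_dichotomy(2)[OF assms(2,4)] by blast
  moreover have "is_metric_dual_of (L_net V) q"
    using metric_dual_involution nvL indep unfolding q_def by blast
  moreover have "metric_dual_koenigs_dual F (L_net V)"
    using assms(1) qL nv nvL kd by (simp add: metric_dual_koenigs_dual_def q_def)
  ultimately show ?thesis using kd kn unfolding q_def by blast
qed

end
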